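(* Let $\mathbb{K}\in\{\mathbb{R},\mathbb{C}\}$, let $\mathbf{A},\mathbf{C}\in\mathbb{IK}^{m\times m}$, $\mathbf{B},\mathbf{D}\in\mathbb{IK}^{n\times n}$, $\mathbf{F}\in\mathbb{IK}^{m\times n}$, and let $$\Xi=\{X\in\mathbb{K}^{m\times n}:\ \exists A\in\mathbf{A},\ \exists B\in\mathbf{B},\ \exists C\in\mathbf{C},\ \exists D\in\mathbf{D},\ \exists F\in\mathbf{F},\ AXB+CXD=F\}$$ be the united solution set of the interval generalized Sylvester matrix equation $\mathbf{A}X\mathbf{B}+\mathbf{C}X\mathbf{D}=\mathbf{F}$. Let $U,V,\mathbf{A}_p,\mathbf{B}_p,\mathbf{C}_p,\mathbf{D}_p,\mathbf{F}_p$ and $a,b,c,d$ be as in the context, and let an initial enclosure $\mathbf{Y}\in\mathbb{IK}^{m\times n}$ for the solution set of the interval system $\mathbf{A}_pY\mathbf{B}_p+\mathbf{C}_pY\mathbf{D}_p=\mathbf{F}_p$ be given, i.e. $Y\in\mathbf{Y}$ whenever $A_pYB_p+C_pYD_p=F_p$ for some $A_p\in\mathbf{A}_p$, $B_p\in\mathbf{B}_p$, $C_p\in\mathbf{C}_p$, $D_p\in\mathbf{D}_p$, $F_p\in\mathbf{F}_p$. Consider the iteration $\mathbf{Y}^{(0)}=\mathbf{Y}$ and, for $k=0,1,\dots$, $$T^{(k)}=\operatorname{mag}(\mathbf{A}_p)|\mathbf{Y}^{(k)}|B_p^{\Delta}+A_p^{\Delta}|\mathbf{Y}^{(k)}B_p^{c}|+\operatorname{mag}(\mathbf{C}_p)|\mathbf{Y}^{(k)}|D_p^{\Delta}+C_p^{\Delta}|\mathbf{Y}^{(k)}D_p^{c}|+F_p^{\Delta},$$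 $$\mathbf{Y}^{(k+1)}=\Big([F_p^{c}-T^{(k)},\,F_p^{c}+T^{(k)}]\,./\,(ab^{\top}+cd^{\top})\Big)\cap\mathbf{Y}^{(k)}.$$ If the interval matrix $\mathbf{Z}\in\mathbb{IK}^{m\times n}$ is obtained by applying this iteration, then $\Xi\subseteq U\mathbf{Z}V^{-1}$, where $U\mathbf{Z}V^{-1}=\{UYV^{-1}:Y\in\mathbf{Z}\}$.
   Context: Intervals. Intervals over $\mathbb{K}$ are represented in one of two ways: in infimum-supremum form $[\underline{x},\overline{x}]=\{x\in\mathbb{K}:\underline{x}\le x\le\overline{x}\}$ with $\underline{x},\overline{x}\in\mathbb{K}$, $\underline{x}\le\overline{x}$, where $x\le y$ means $\operatorname{Re}(x)\le\operatorname{Re}(y)$ and $\operatorname{Im}(x)\le\operatorname{Im}(y)$; or in midpoint-radius form $\langle x^{c},x^{\Delta}\rangle=\{x\in\mathbb{K}:|x-x^{c}|\le x^{\Delta}\}$ with midpoint $x^{c}\in\mathbb{K}$ and radius $0\le x^{\Delta}\in\mathbb{R}$. For $\mathbb{K}=\mathbb{R}$ the two representations are identical. $\mathbb{IK}^{p\times q}$ is the set of $p\times q$ matrices of intervals over $\mathbb{K}$; membership, inclusion and intersection are entrywise, and $[G,H]$ for matrices $G\le H$ is the interval matrix with entries $[G_{ij},H_{ij}]$; $M^{c},M^{\Delta}$ are the midpoint and radius matrices of an interval matrix $\mathbf{M}$. The magnitude of an interval is $\operatorname{mag}(\mathbf{x})=|\mathbf{x}|=\max\{|x|:x\in\mathbf{x}\}=|x^{c}|+x^{\Delta}$,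 applied entrywise to interval matrices. $./$ denotes entrywise (Hadamard) division. Interval operations are evaluated in an interval arithmetic with the enclosure property $\{x\circ y:x\in\mathbf{x},y\in\mathbf{y}\}\subseteq\mathbf{x}\circ\mathbf{y}$ for $\circ\in\{+,-,\cdot,/\}$. Setting. There are invertible $U\in\mathbb{K}^{m\times m}$, $V\in\mathbb{K}^{n\times n}$ and diagonal $D_A,D_C\in\mathbb{K}^{m\times m}$, $D_B,D_D\in\mathbb{K}^{n\times n}$ with $A^{c}=UD_AU^{-1}$, $C^{c}=UD_CU^{-1}$, $B^{c}=VD_BV^{-1}$, $D^{c}=VD_DV^{-1}$. Put $\mathbf{A}_p=U^{-1}\mathbf{A}U$, $\mathbf{B}_p=V^{-1}\mathbf{B}V$, $\mathbf{C}_p=U^{-1}\mathbf{C}U$, $\mathbf{D}_p=V^{-1}\mathbf{D}V$, $\mathbf{F}_p=U^{-1}\mathbf{F}V$ (interval evaluations). The vectors $a,c\in\mathbb{K}^{m}$ and $b,d\in\mathbb{K}^{n}$ are such that $A_p^{c}=\operatorname{Diag}(a)$, $B_p^{c}=\operatorname{Diag}(b)$, $C_p^{c}=\operatorname{Diag}(c)$, $D_p^{c}=\operatorname{Diag}(d)$, where $\operatorname{Diag}(g)$ is the diagonal matrix with diagonal $g$. The iteration is terminated when the distance between two successive iterates becomes smaller than a given tolerance.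
   Formalization: For K=C, [F_p^c−T, F_p^c+T] is read as the disc ⟨F_p^c,T⟩ or the square F_p^c±T(1+i), since the literal segment makes the claim false (A=B=1, C=D=0, F=Y=unit disc); a complex rectangle's radius is half its diagonal; all entries of ab^T+cd^T are assumed nonzero. *)

theory Defs
  imports "HOL-Analysis.Analysis"
begin

text \<open>
  The scalar domain is a type \<open>'k\<close> of sort \<open>{real_normed_field, euclidean_space}\<close>. Both
  \<^typ>\<open>real\<close> and \<^typ>\<open>complex\<close> are of this sort; the componentwise order is taken with
  respect to \<^const>\<open>Basis\<close>, i.e. it is the usual order on \<^typ>\<open>real\<close> and the order of real and
  imaginary parts on \<^typ>\<open>complex\<close> (see \<open>comp_le_real\<close>, \<open>comp_le_complex\<close>).

  An interval is the set of its points, so it does not matter which of the two representations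
  it is given in. Interval matrices are matrices whose entries are such sets.
\<close>

definition comp_le :: "'k :: euclidean_space \<Rightarrow> 'k \<Rightarrow> bool" where
  "comp_le x y \<longleftrightarrow> (\<forall>b\<in>Basis. x \<bullet> b \<le> y \<bullet> b)"

definition infsup :: "'k \<Rightarrow> 'k \<Rightarrow> 'k :: euclidean_space set" where
  "infsup l u = {x. comp_le l x \<and> comp_le x u}"

definition midrad :: "'k \<Rightarrow> real \<Rightarrow> 'k :: real_normed_vector set" where
  "midrad c r = {x. norm (x - c) \<le> r}"

definition intervals :: "'k :: {real_normed_field, euclidean_space} set set" where
  "intervals = {infsup l u | l u. comp_le l u} \<union> {midrad c r | c r. 0 \<le> r}"

lemma comp_le_real: "comp_le (x::real) y \<longleftrightarrow> x \<le> y"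
  by (simp add: comp_le_def)

lemma comp_le_complex: "comp_le x y \<longleftrightarrow> Re x \<le> Re y \<and> Im x \<le> Im y"
  by (simp add: comp_le_def Basis_complex_def)

lemma infsup_eq_cbox: "infsup l u = cbox l u"
  by (auto simp: infsup_def comp_le_def mem_box)

lemma midrad_eq_cball: "midrad c r = cball c r"
  by (auto simp: midrad_def dist_norm norm_minus_commute)

lemma infsup_real: "infsup (l::real) u = {l..u}"
  by (auto simp: infsup_def comp_le_real)

lemma midrad_real: "midrad (c::real) r = {c - r..c + r}"
  by (auto simp: midrad_def)

text \<open>
  Midpoint and radius. The radius is a real number; for a rectangle in the complex plane (whose
  midpoint-radius data are those of its circumscribed disc) it is half the length of the diagonal.
\<close>

definition imid :: "'k :: {real_normed_field, euclidean_space} set \<Rightarrow> 'k" where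
  "imid X = (THE c. (\<exists>r\<ge>0. X = midrad c r) \<or>
                    (\<exists>l u. comp_le l u \<and> X = infsup l u \<and> c = (l + u) / 2))"

definition irad :: "'k :: {real_normed_field, euclidean_space} set \<Rightarrow> real" where
  "irad X = (THE r. (\<exists>c. 0 \<le> r \<and> X = midrad c r) \<or>
                    (\<exists>l u. comp_le l u \<and> X = infsup l u \<and> r = norm (u - l) / 2))"

definition mag :: "'k :: real_normed_vector set \<Rightarrow> real" where
  "mag X = (SUP x\<in>X. norm x)"

lemma symmetric_centre_unique:
  fixes X :: "'k :: euclidean_space set"
  assumes "compact X" "X \<noteq> {}"
    and c: "\<And>x. x \<in> X \<Longrightarrow> 2 *\<^sub>R c - x \<in> X" and c': "\<And>x. x \<in> X \<Longrightarrow> 2 *\<^sub>R c' - x \<in> X"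
  shows "c = c'"
proof -
  define v where "v = c' - c"
  have "continuous_on X (\<lambda>x. x \<bullet> v)"
    by (intro continuous_intros)
  then obtain x where x: "x \<in> X" "\<And>y. y \<in> X \<Longrightarrow> y \<bullet> v \<le> x \<bullet> v"
    using continuous_attains_sup[OF assms(1,2)] by blast
  have "2 *\<^sub>R c' - (2 *\<^sub>R c - x) \<in> X"
    using c c' x by blast
  also have "2 *\<^sub>R c' - (2 *\<^sub>R c - x) = x + 2 *\<^sub>R v"
    by (simp add: v_def algebra_simps)
  finally have "(x + 2 *\<^sub>R v) \<bullet> v \<le> x \<bullet> v"
    by (rule x(2))
  then have "v \<bullet> v \<le> 0"
    by (simp add: inner_add_left)
  then have "v = 0"
    by (metis inner_eq_zero_iff inner_ge_zero order_antisym)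
  then show ?thesis
    by (simp add: v_def)
qed

lemma midrad_reflect: "x \<in> midrad c r \<Longrightarrow> 2 *\<^sub>R c - x \<in> midrad c r"
proof -
  have "2 *\<^sub>R c - x - c = c - x"
    by (simp add: scaleR_2)
  then show "x \<in> midrad c r \<Longrightarrow> 2 *\<^sub>R c - x \<in> midrad c r"
    by (simp only: midrad_def mem_Collect_eq norm_minus_commute[of c x])
qed

lemma half_scaleR: "2 *\<^sub>R ((l + u) / 2) = l + (u :: 'k :: real_normed_field)"
  by (simp add: scaleR_conv_of_real)

lemma infsup_reflect:
  fixes l u :: "'k :: {real_normed_field, euclidean_space}"
  shows "x \<in> infsup l u \<Longrightarrow> 2 *\<^sub>R ((l + u) / 2) - x \<in> infsup l u"
  unfolding half_scaleR by (auto simp: infsup_def comp_le_def inner_simps)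

lemma interval_compact_nonempty:
  assumes "X \<in> intervals"
  shows "compact X" "X \<noteq> {}"
proof -
  consider l u where "comp_le l u" "X = cbox l u" | c r where "0 \<le> r" "X = cball c r"
    using assms by (auto simp: intervals_def infsup_eq_cbox midrad_eq_cball)
  note cases = this
  show "compact X"
    by (cases rule: cases) auto
  show "X \<noteq> {}"
    by (cases rule: cases) (auto simp: box_ne_empty comp_le_def)
qed

lemma imid_midrad:
  fixes c :: "'k :: {real_normed_field, euclidean_space}"
  assumes "0 \<le> r"
  shows "imid (midrad c r) = c"
  unfolding imid_def
proof (rule the_equality)
  show "(\<exists>ra\<ge>0. midrad c r = midrad c ra) \<or>
    (\<exists>l u. comp_le l u \<and> midrad c r = infsup l u \<and> c = (l + u) / 2)"
    using assms by blast
  fix c'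
  assume "(\<exists>ra\<ge>0. midrad c r = midrad c' ra) \<or>
    (\<exists>l u. comp_le l u \<and> midrad c r = infsup l u \<and> c' = (l + u) / 2)"
  then have "\<And>x. x \<in> midrad c r \<Longrightarrow> 2 *\<^sub>R c' - x \<in> midrad c r"
    using midrad_reflect infsup_reflect by metis
  moreover have "midrad c r \<in> intervals"
    using assms by (auto simp: intervals_def)
  ultimately show "c' = c"
    using symmetric_centre_unique interval_compact_nonempty midrad_reflect by metis
qed

lemma imid_infsup:
  fixes l u :: "'k :: {real_normed_field, euclidean_space}"
  assumes "comp_le l u"
  shows "imid (infsup l u) = (l + u) / 2"
  unfolding imid_def
proof (rule the_equality)
  show "(\<exists>r\<ge>0. infsup l u = midrad ((l + u) / 2) r) \<or>
    (\<exists>la ua. comp_le la ua \<and> infsup l u = infsup la ua \<and> (l + u) / 2 = (la + ua) / 2)"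
    using assms by blast
  fix c'
  assume "(\<exists>r\<ge>0. infsup l u = midrad c' r) \<or>
    (\<exists>la ua. comp_le la ua \<and> infsup l u = infsup la ua \<and> c' = (la + ua) / 2)"
  then have "\<And>x. x \<in> infsup l u \<Longrightarrow> 2 *\<^sub>R c' - x \<in> infsup l u"
    using midrad_reflect infsup_reflect by metis
  moreover have "infsup l u \<in> intervals"
    using assms by (auto simp: intervals_def)
  ultimately show "c' = (l + u) / 2"
    using symmetric_centre_unique interval_compact_nonempty infsup_reflect by metis
qed

lemma diameter_midrad: "0 \<le> r \<Longrightarrow> diameter (midrad (c :: 'k :: euclidean_space) r) = 2 * r"
  by (simp add: midrad_eq_cball)

lemma diameter_infsup: "comp_le l u \<Longrightarrow> diameter (infsup l u) = norm (u - l)"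
  by (simp add: infsup_eq_cbox comp_le_def diameter_cbox dist_norm norm_minus_commute)

lemma irad_midrad:
  fixes c :: "'k :: {real_normed_field, euclidean_space}"
  assumes "0 \<le> r"
  shows "irad (midrad c r) = r"
  unfolding irad_def
proof (rule the_equality)
  fix r'
  assume "(\<exists>ca. 0 \<le> r' \<and> midrad c r = midrad ca r') \<or>
    (\<exists>l u. comp_le l u \<and> midrad c r = infsup l u \<and> r' = norm (u - l) / 2)"
  then have "diameter (midrad c r) = 2 * r'"
    by (auto simp: diameter_midrad diameter_infsup)
  then show "r' = r"
    using assms by (simp add: diameter_midrad)
qed (use assms in blast)

lemma irad_infsup:
  fixes l u :: "'k :: {real_normed_field, euclidean_space}"
  assumes "comp_le l u"
  shows "irad (infsup l u) = norm (u - l) / 2"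
  unfolding irad_def
proof (rule the_equality)
  fix r'
  assume "(\<exists>ca. 0 \<le> r' \<and> infsup l u = midrad ca r') \<or>
    (\<exists>la ua. comp_le la ua \<and> infsup l u = infsup la ua \<and> r' = norm (ua - la) / 2)"
  then have "diameter (infsup l u) = 2 * r'"
    by (auto simp: diameter_midrad diameter_infsup)
  then show "r' = norm (u - l) / 2"
    using assms by (simp add: diameter_infsup)
qed (use assms in blast)

lemma mag_midrad:
  fixes c :: "'k :: {real_normed_field, euclidean_space}"
  assumes "0 \<le> r"
  shows "mag (midrad c r) = norm c + r"
  unfolding mag_def
proof (rule cSup_eq_maximum)
  define e :: 'k where "e = (if c = 0 then 1 else c / of_real (norm c))"
  have e: "norm e = 1" "c = of_real (norm c) * e"
    by (auto simp: e_def norm_divide)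
  have "c + of_real r * e = of_real (norm c + r) * e"
    using e(2) by (simp add: distrib_right)
  then have "norm (c + of_real r * e) = norm c + r"
    using assms e(1) by (simp add: norm_mult del: of_real_add)
  moreover have "c + of_real r * e \<in> midrad c r"
    using assms e(1) by (simp add: midrad_def norm_mult)
  ultimately show "norm c + r \<in> norm ` midrad c r"
    by (metis image_eqI)
  show "y \<le> norm c + r" if "y \<in> norm ` midrad c r" for y
  proof -
    obtain x where x: "y = norm x" "norm (x - c) \<le> r"
      using \<open>y \<in> norm ` midrad c r\<close> by (auto simp: midrad_def)
    then show ?thesis
      using norm_triangle_sub[of x c] by simp
  qed
qed

text \<open>
  \<open>[c - t, c + t]\<close> for a real \<open>t \<ge> 0\<close>. For real \<open>c\<close> both elements of the set are \<open>{c - t..c + t}\<close>.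
  For complex \<open>c\<close> the real number \<open>t\<close> has to bound the deviation in every direction, so that the
  interval is the disc of radius \<open>t\<close> in midpoint-radius form and the square with half side \<open>t\<close> in
  infimum-supremum form; note that \<open>\<Sum>Basis\<close> is \<open>1 + \<i>\<close>. (The set of all \<open>x\<close> with
  \<open>c - t \<le> x \<le> c + t\<close>, which is a segment parallel to the real axis, is not meant.)
\<close>

definition pm_intervals ::
    "'k \<Rightarrow> real \<Rightarrow> 'k :: {real_normed_field, euclidean_space} set set" where
  "pm_intervals c t = {midrad c t, infsup (c - t *\<^sub>R (\<Sum>Basis)) (c + t *\<^sub>R (\<Sum>Basis))}"

lemma pm_intervals_real: "pm_intervals (c::real) t = {{c - t..c + t}}"
  by (auto simp: pm_intervals_def midrad_real infsup_real)

text \<open>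
  Intersection of two intervals as an interval. It is the set-theoretic intersection whenever
  that is an interval, in particular always when the intersection of two real intervals, or of
  two complex rectangles, is nonempty. The intersection of two discs is in general not an
  interval; an interval containing it is used then. An empty intersection is not an interval, and
  no result exists.
\<close>

definition interval_inter ::
    "'k :: {real_normed_field, euclidean_space} set \<Rightarrow> 'k set \<Rightarrow> 'k set \<Rightarrow> bool" where
  "interval_inter X Y Z \<longleftrightarrow> Z \<in> intervals \<and> X \<inter> Y \<noteq> {} \<and>
     (if X \<inter> Y \<in> intervals then Z = X \<inter> Y else X \<inter> Y \<subseteq> Z)"

definition interval_arithmetic ::
    "('k :: {real_normed_field, euclidean_space} set \<Rightarrow> 'k set \<Rightarrow> 'k set) \<Rightarrow>
     ('k set \<Rightarrow> 'k set \<Rightarrow> 'k set) \<Rightarrow> ('k set \<Rightarrow> 'k set \<Rightarrow> 'k set) \<Rightarrow>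
     ('k set \<Rightarrow> 'k set \<Rightarrow> 'k set) \<Rightarrow> bool" where
  "interval_arithmetic iadd isub imul idiv \<longleftrightarrow>
     (\<forall>X\<in>intervals. \<forall>Y\<in>intervals.
        iadd X Y \<in> intervals \<and> {x + y | x y. x \<in> X \<and> y \<in> Y} \<subseteq> iadd X Y \<and>
        isub X Y \<in> intervals \<and> {x - y | x y. x \<in> X \<and> y \<in> Y} \<subseteq> isub X Y \<and>
        imul X Y \<in> intervals \<and> {x * y | x y. x \<in> X \<and> y \<in> Y} \<subseteq> imul X Y \<and>
        (0 \<notin> Y \<longrightarrow> idiv X Y \<in> intervals \<and> {x / y | x y. x \<in> X \<and> y \<in> Y} \<subseteq> idiv X Y))"

text \<open>
  Interval matrices and their evaluation. Interval addition need not be associative (rounding),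
  so that the value of an interval matrix product depends on the order of evaluation:
  \<open>imatrix_prod iadd imul M N P\<close> says that \<open>P\<close> is the product of \<open>M\<close> and \<open>N\<close> evaluated
  in some order, and \<open>imatrix_prod3\<close> is the analogue for three factors.
\<close>

definition interval_matrix ::
    "'k :: {real_normed_field, euclidean_space} set ^'q^'p \<Rightarrow> bool" where
  "interval_matrix M \<longleftrightarrow> (\<forall>i j. M $ i $ j \<in> intervals)"

definition imembers :: "'k set ^'q^'p \<Rightarrow> ('k ^'q^'p) set" where
  "imembers M = {X. \<forall>i j. X $ i $ j \<in> M $ i $ j}"

definition point_matrix :: "'k ^'q^'p \<Rightarrow> 'k set ^'q^'p" where
  "point_matrix X = map_matrix (\<lambda>x. {x}) X"

inductive isum ::
    "('k set \<Rightarrow> 'k set \<Rightarrow> 'k set) \<Rightarrow> ('i \<Rightarrow> 'k set) \<Rightarrow> 'i set \<Rightarrow> 'k set \<Rightarrow> bool"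
  for iadd f where
  single: "isum iadd f {i} (f i)"
| join: "isum iadd f I X \<Longrightarrow> isum iadd f J Y \<Longrightarrow> I \<inter> J = {} \<Longrightarrow> isum iadd f (I \<union> J) (iadd X Y)"

definition imatrix_prod ::
    "('k set \<Rightarrow> 'k set \<Rightarrow> 'k set) \<Rightarrow> ('k set \<Rightarrow> 'k set \<Rightarrow> 'k set) \<Rightarrow>
     'k set ^'r^'p \<Rightarrow> 'k set ^'q^'r \<Rightarrow> 'k set ^'q^'p \<Rightarrow> bool" where
  "imatrix_prod iadd imul M N P \<longleftrightarrow>
     (\<forall>i j. isum iadd (\<lambda>k. imul (M $ i $ k) (N $ k $ j)) UNIV (P $ i $ j))"

definition imatrix_prod3 ::
    "('k set \<Rightarrow> 'k set \<Rightarrow> 'k set) \<Rightarrow> ('k set \<Rightarrow> 'k set \<Rightarrow> 'k set) \<Rightarrow>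
     'k set ^'r^'p \<Rightarrow> 'k set ^'s^'r \<Rightarrow> 'k set ^'q^'s \<Rightarrow> 'k set ^'q^'p \<Rightarrow> bool" where
  "imatrix_prod3 iadd imul L M N P \<longleftrightarrow>
     (\<exists>Q. imatrix_prod iadd imul L M Q \<and> imatrix_prod iadd imul Q N P) \<or>
     (\<exists>Q. imatrix_prod iadd imul M N Q \<and> imatrix_prod iadd imul L Q P)"

definition Diag :: "'a :: zero ^'p \<Rightarrow> 'a ^'p^'p" where
  "Diag g = (\<chi> i j. if i = j then g $ i else 0)"

definition diagonal_matrix :: "'a :: zero ^'p^'p \<Rightarrow> bool" where
  "diagonal_matrix M \<longleftrightarrow> (\<forall>i j. i \<noteq> j \<longrightarrow> M $ i $ j = 0)"

definition united_solution_set ::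
    "'k :: real_normed_field set ^'m^'m \<Rightarrow> 'k set ^'n^'n \<Rightarrow> 'k set ^'m^'m \<Rightarrow> 'k set ^'n^'n \<Rightarrow>
     'k set ^'n^'m \<Rightarrow> ('k ^'n^'m) set" where
  "united_solution_set \<A> \<B> \<C> \<D> \<F> =
     {X. \<exists>A\<in>imembers \<A>. \<exists>B\<in>imembers \<B>. \<exists>C\<in>imembers \<C>. \<exists>D\<in>imembers \<D>. \<exists>F\<in>imembers \<F>.
           A ** X ** B + C ** X ** D = F}"

end

theory Submission
  imports Defs
begin

text \<open>
  Substitute \<open>Y = U\<^sup>-\<^sup>1 X V\<close>. If \<open>A X B + C X D = F\<close>, then cancelling \<open>U U\<^sup>-\<^sup>1\<close> and \<open>V V\<^sup>-\<^sup>1\<close>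
  gives \<open>P Y Q + R Y S = G\<close> with \<open>P = U\<^sup>-\<^sup>1 A U\<close>, \<open>Q = V\<^sup>-\<^sup>1 B V\<close>, \<open>R = U\<^sup>-\<^sup>1 C U\<close>, \<open>S = V\<^sup>-\<^sup>1 D V\<close>,
  \<open>G = U\<^sup>-\<^sup>1 F V\<close>. The enclosure property, carried through sums and matrix products in any order of
  evaluation (\<open>imatrix_prod3_encloses\<close>), puts these five matrices into the preconditioned interval
  matrices, so \<open>Y\<close> lies in the initial enclosure. It remains to see that an iteration step never
  discards such a \<open>Y\<close>.

  Write \<open>P\<^sup>c, Q\<^sup>c, \<dots>\<close> for the midpoints of the interval matrices that contain \<open>P, Q, \<dots>\<close>. For the
  four coefficients they are diagonal, so the entries of \<open>P\<^sup>c Y Q\<^sup>c + R\<^sup>c Y S\<^sup>c\<close> are \<open>(a\<^sub>i b\<^sub>j + c\<^sub>i d\<^sub>j) Y\<^sub>i\<^sub>j\<close>. On the other hand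
  \<open>P Y Q = P\<^sup>c Y Q\<^sup>c + P Y (Q - Q\<^sup>c) + (P - P\<^sup>c) (Y Q\<^sup>c)\<close>, and similarly for \<open>R Y S\<close>, so the equation
  says that \<open>P\<^sup>c Y Q\<^sup>c + R\<^sup>c Y S\<^sup>c\<close> differs from \<open>G\<^sup>c\<close> by \<open>G - G\<^sup>c\<close> and four products each containing
  one deviation from a midpoint. Bounding members by magnitudes and deviations by radii, these five
  terms become exactly the five summands of \<open>T\<close> (\<open>midpoint_residual_bound\<close>). Hence
  \<open>(a\<^sub>i b\<^sub>j + c\<^sub>i d\<^sub>j) Y\<^sub>i\<^sub>j\<close> lies in the disc of radius \<open>T\<^sub>i\<^sub>j\<close> around \<open>G\<^sup>c\<^sub>i\<^sub>j\<close>, and so in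
  \<open>[G\<^sup>c - T, G\<^sup>c + T]\<close> in either representation; dividing by the nonzero coefficient keeps \<open>Y\<close> in the
  next iterate.
\<close>

section \<open>Members, magnitudes and radii of intervals\<close>

lemma singleton_in_intervals: "{x} \<in> intervals"
proof -
  have "{x} = midrad x 0"
    by (auto simp: midrad_def)
  then show ?thesis
    by (auto simp: intervals_def)
qed

text \<open>Compactness of intervals makes the supremum in \<^const>\<open>mag\<close> finite.\<close>

lemma norm_le_mag:
  assumes "X \<in> intervals" "x \<in> X"
  shows "norm x \<le> mag X"
proof -
  have "bounded X"
    using interval_compact_nonempty(1)[OF assms(1)] by (rule compact_imp_bounded)
  then have "bdd_above (norm ` X)"
    by (auto simp: bounded_iff bdd_above_def)
  then show ?thesis
    unfolding mag_def using assms(2) by (rule cSUP_upper2) simp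
qed

text \<open>
  For a box, each coordinate of \<open>x\<close> is within half the side length of the midpoint, so \<open>x\<close> is within
  half the diagonal of it: the box lies in its circumscribed ball.
\<close>

lemma dist_imid_le_irad:
  assumes "X \<in> intervals" "x \<in> X"
  shows "norm (x - imid X) \<le> irad X"
proof -
  consider (box) l u where "comp_le l u" "X = infsup l u" | (ball) c r where "0 \<le> r" "X = midrad c r"
    using assms(1) by (auto simp: intervals_def)
  then show ?thesis
  proof cases
    case box
    have mid: "(l + u) / 2 = (1/2) *\<^sub>R (l + u)"
      by (simp add: scaleR_conv_of_real)
    have "norm (x - (l + u) / 2) \<le> norm ((1/2) *\<^sub>R (u - l))"
    proof (rule norm_le_componentwise)
      fix e :: 'a
      assume "e \<in> Basis"
      then have "l \<bullet> e \<le> x \<bullet> e" "x \<bullet> e \<le> u \<bullet> e"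
        using assms(2) box by (auto simp: infsup_def comp_le_def)
      then show "\<bar>(x - (l + u) / 2) \<bullet> e\<bar> \<le> \<bar>((1/2) *\<^sub>R (u - l)) \<bullet> e\<bar>"
        unfolding mid by (simp add: inner_simps abs_if field_simps)
    qed
    then show ?thesis
      using box by (simp add: imid_infsup irad_infsup)
  next
    case ball
    then have "norm (x - c) \<le> r"
      using assms(2) by (simp add: midrad_def)
    then show ?thesis
      using ball by (simp add: imid_midrad irad_midrad)
  qed
qed

text \<open>
  The disc of radius \<open>t\<close> is the smaller of the two readings of \<open>[c - t, c + t]\<close>, because a coordinate
  of a vector is at most its norm.
\<close>

lemma pm_intervals_contains_ball:
  assumes "norm (x - c) \<le> t" "J \<in> pm_intervals c t"
  shows "J \<in> intervals" "x \<in> J"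
proof -
  have t: "0 \<le> t"
    using assms(1) norm_ge_zero order_trans by blast
  have basis: "(\<Sum>Basis) \<bullet> e = 1" if "e \<in> Basis" for e :: 'a
    using that by simp
  consider "J = midrad c t" | "J = infsup (c - t *\<^sub>R (\<Sum>Basis)) (c + t *\<^sub>R (\<Sum>Basis))"
    using assms(2) by (auto simp: pm_intervals_def)
  then have "J \<in> intervals \<and> x \<in> J"
  proof cases
    case 1
    then show ?thesis
      using assms(1) t by (auto simp: intervals_def midrad_def)
  next
    case 2
    have "c \<bullet> e - t \<le> x \<bullet> e \<and> x \<bullet> e \<le> c \<bullet> e + t" if "e \<in> Basis" for e
      using Basis_le_norm[OF that, of "x - c"] assms(1) by (auto simp: inner_simps)
    then have "x \<in> J"
      using 2 by (auto simp: infsup_def comp_le_def inner_simps basis)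
    moreover have "comp_le (c - t *\<^sub>R (\<Sum>Basis)) (c + t *\<^sub>R (\<Sum>Basis))"
      using t by (auto simp: comp_le_def inner_simps basis)
    ultimately show ?thesis
      using 2 by (auto simp: intervals_def)
  qed
  then show "J \<in> intervals" "x \<in> J"
    by auto
qed

lemma interval_inter_encloses:
  assumes "interval_inter X Y Z"
  shows "Z \<in> intervals" "X \<inter> Y \<subseteq> Z"
  using assms by (auto simp: interval_inter_def split: if_splits)

section \<open>Enclosure by interval matrix products\<close>

lemma interval_arithmeticD:
  assumes "interval_arithmetic iadd isub imul idiv" "X \<in> intervals" "Y \<in> intervals"
  shows "iadd X Y \<in> intervals" "x \<in> X \<Longrightarrow> y \<in> Y \<Longrightarrow> x + y \<in> iadd X Y"
    "imul X Y \<in> intervals" "x \<in> X \<Longrightarrow> y \<in> Y \<Longrightarrow> x * y \<in> imul X Y"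
    "0 \<notin> Y \<Longrightarrow> x \<in> X \<Longrightarrow> y \<in> Y \<Longrightarrow> x / y \<in> idiv X Y"
proof -
  note XY = assms(1)[unfolded interval_arithmetic_def, rule_format, OF assms(2,3)]
  show "iadd X Y \<in> intervals" "imul X Y \<in> intervals"
    using XY by simp_all
  have sub: "{x + y | x y. x \<in> X \<and> y \<in> Y} \<subseteq> iadd X Y"
    "{x * y | x y. x \<in> X \<and> y \<in> Y} \<subseteq> imul X Y"
    "0 \<notin> Y \<Longrightarrow> {x / y | x y. x \<in> X \<and> y \<in> Y} \<subseteq> idiv X Y"
    using XY by simp_all
  show "x \<in> X \<Longrightarrow> y \<in> Y \<Longrightarrow> x + y \<in> iadd X Y"
    using sub(1) by blast
  show "x \<in> X \<Longrightarrow> y \<in> Y \<Longrightarrow> x * y \<in> imul X Y"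
    using sub(2) by blast
  show "0 \<notin> Y \<Longrightarrow> x \<in> X \<Longrightarrow> y \<in> Y \<Longrightarrow> x / y \<in> idiv X Y"
    using sub(3) by blast
qed

text \<open>
  \<^const>\<open>sum\<close> vanishes on infinite index sets, so finiteness of the index set has to be carried along
  the induction over the order of evaluation.
\<close>

lemma isum_encloses:
  assumes "isum iadd f I X"
    and arith: "interval_arithmetic iadd isub imul idiv"
    and f: "\<And>i. i \<in> I \<Longrightarrow> f i \<in> intervals" and g: "\<And>i. i \<in> I \<Longrightarrow> g i \<in> f i"
  shows "finite I \<and> X \<in> intervals \<and> sum g I \<in> X"
  using assms(1) f g
proof (induction rule: isum.induct)
  case (single i)
  then show ?case by simp
next
  case (join I X J Y)
  then have IX: "finite I" "X \<in> intervals" "sum g I \<in> X"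
    and JY: "finite J" "Y \<in> intervals" "sum g J \<in> Y"
    by auto
  have "iadd X Y \<in> intervals" "sum g I + sum g J \<in> iadd X Y"
    using interval_arithmeticD(1,2)[OF arith IX(2) JY(2)] IX(3) JY(3) by simp_all
  then show ?case
    using IX JY join.hyps by (simp add: sum.union_disjoint)
qed

lemma imatrix_prod_encloses:
  assumes arith: "interval_arithmetic iadd isub imul idiv"
    and prod: "imatrix_prod iadd imul M N P"
    and M: "interval_matrix M" "X \<in> imembers M" and N: "interval_matrix N" "Y \<in> imembers N"
  shows "interval_matrix P" "X ** Y \<in> imembers P"
proof -
  have "P $ i $ j \<in> intervals \<and> (X ** Y) $ i $ j \<in> P $ i $ j" for i j
  proof -
    have mul: "imul (M $ i $ k) (N $ k $ j) \<in> intervals \<and>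
        X $ i $ k * Y $ k $ j \<in> imul (M $ i $ k) (N $ k $ j)" for k
    proof -
      have "M $ i $ k \<in> intervals" "N $ k $ j \<in> intervals"
          "X $ i $ k \<in> M $ i $ k" "Y $ k $ j \<in> N $ k $ j"
        using M N by (auto simp: interval_matrix_def imembers_def)
      then show ?thesis
        using interval_arithmeticD(3,4)[OF arith] by simp
    qed
    have "isum iadd (\<lambda>k. imul (M $ i $ k) (N $ k $ j)) UNIV (P $ i $ j)"
      using prod by (simp add: imatrix_prod_def)
    from isum_encloses[OF this arith, where g = "\<lambda>k. X $ i $ k * Y $ k $ j"] mul
    show ?thesis
      by (simp add: matrix_matrix_mult_def)
  qed
  then show "interval_matrix P" "X ** Y \<in> imembers P"
    by (auto simp: interval_matrix_def imembers_def)
qed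

lemma imatrix_prod3_encloses:
  assumes arith: "interval_arithmetic iadd isub imul idiv"
    and prod: "imatrix_prod3 iadd imul L M N P"
    and L: "interval_matrix L" "X \<in> imembers L" and M: "interval_matrix M" "Y \<in> imembers M"
    and N: "interval_matrix N" "Z \<in> imembers N"
  shows "interval_matrix P" "X ** Y ** Z \<in> imembers P"
proof -
  consider Q where "imatrix_prod iadd imul L M Q" "imatrix_prod iadd imul Q N P"
    | Q where "imatrix_prod iadd imul M N Q" "imatrix_prod iadd imul L Q P"
    using prod unfolding imatrix_prod3_def by blast
  then have "interval_matrix P \<and> X ** Y ** Z \<in> imembers P"
  proof cases
    case 1
    show ?thesis
      using imatrix_prod_encloses[OF arith 1(2) imatrix_prod_encloses[OF arith 1(1) L M] N] by blast
  next
    case 2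
    show ?thesis
      using imatrix_prod_encloses[OF arith 2(2) L imatrix_prod_encloses[OF arith 2(1) M N]]
      by (simp add: matrix_mul_assoc)
  qed
  then show "interval_matrix P" "X ** Y ** Z \<in> imembers P"
    by auto
qed

lemma point_matrix_interval:
  "interval_matrix (point_matrix X)" "X \<in> imembers (point_matrix X)"
  by (simp_all add: interval_matrix_def imembers_def point_matrix_def
      singleton_in_intervals)

section \<open>Entrywise majorants\<close>

definition majorized :: "'a :: real_normed_field ^'q^'p \<Rightarrow> real ^'q^'p \<Rightarrow> bool" where
  "majorized M P \<longleftrightarrow> (\<forall>i j. norm (M $ i $ j) \<le> P $ i $ j)"

lemma majorized_mult:
  assumes "majorized M P" "majorized N Q"
  shows "majorized (M ** N) (P ** Q)"
  unfolding majorized_def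
proof (intro allI)
  fix i j
  have "norm (M $ i $ k * N $ k $ j) \<le> P $ i $ k * Q $ k $ j" for k
    unfolding norm_mult using assms
    by (intro mult_mono) (auto simp: majorized_def intro: order_trans[OF norm_ge_zero])
  then show "norm ((M ** N) $ i $ j) \<le> (P ** Q) $ i $ j"
    by (auto simp: matrix_matrix_mult_def intro: sum_norm_le)
qed

lemma majorized_add: "majorized M P \<Longrightarrow> majorized N Q \<Longrightarrow> majorized (M + N) (P + Q)"
  by (auto simp: majorized_def intro: norm_triangle_mono)

lemma majorized_minus: "majorized (- M) P \<longleftrightarrow> majorized M P"
  by (simp add: majorized_def)

lemma majorized_mag:
  "interval_matrix M \<Longrightarrow> X \<in> imembers M \<Longrightarrow> majorized X (map_matrix mag M)"
  by (simp add: majorized_def interval_matrix_def imembers_def norm_le_mag)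

lemma majorized_irad:
  "interval_matrix M \<Longrightarrow> X \<in> imembers M \<Longrightarrow> majorized (X - map_matrix imid M) (map_matrix irad M)"
  by (simp add: majorized_def interval_matrix_def imembers_def dist_imid_le_irad)

section \<open>The midpoint residual of a solution\<close>

lemma matrix_add_rdistrib:
  fixes A B :: "'a :: semiring_1 ^'r^'p" and C :: "'a ^'q^'r"
  shows "(A + B) ** C = A ** C + B ** C"
  by (simp add: vec_eq_iff matrix_matrix_mult_def sum.distrib distrib_right)

text \<open>
  The two factors are replaced by their midpoints one after the other: first \<open>Q\<close>, next to the full
  \<open>P\<close>, then \<open>P\<close>, next to the midpoint \<open>Q'\<close>. Hence no product of two deviations appears.
\<close>

lemma product_midpoint_split:
  fixes P P' :: "'a :: comm_ring_1 ^'m^'m" and Y :: "'a ^'n^'m" and Q Q' :: "'a ^'n^'n"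
  shows "P ** Y ** Q = P' ** Y ** Q' + (P ** Y ** (Q - Q') + (P - P') ** (Y ** Q'))"
proof -
  have "P ** Y ** (Q' + (Q - Q')) = P ** Y ** Q' + P ** Y ** (Q - Q')"
    by (rule matrix_add_ldistrib)
  moreover have "(P' + (P - P')) ** (Y ** Q') = P' ** (Y ** Q') + (P - P') ** (Y ** Q')"
    by (rule matrix_add_rdistrib)
  ultimately show ?thesis
    by (simp add: matrix_mul_assoc)
qed

text \<open>
  The products \<open>Y Q'\<close> and \<open>Y S'\<close> have majorants of their own: when \<open>Q'\<close> is a known point matrix, they
  can be enclosed directly, which can be sharper than multiplying a majorant of \<open>Y\<close> by one of \<open>Q'\<close>.
\<close>

lemma midpoint_residual_bound:
  fixes P R :: "'a :: real_normed_field ^'m^'m" and Q S :: "'a ^'n^'n" and Y G :: "'a ^'n^'m"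
  assumes eq: "P ** Y ** Q + R ** Y ** S = G"
    and P: "majorized P MP" "majorized (P - P') RP" and Q: "majorized (Q - Q') RQ"
    and R: "majorized R MR" "majorized (R - R') RR" and S: "majorized (S - S') RS"
    and Y: "majorized Y MY" "majorized (Y ** Q') MYQ" "majorized (Y ** S') MYS"
    and G: "majorized (G - G') RG"
  shows "majorized (P' ** Y ** Q' + R' ** Y ** S' - G')
    (MP ** MY ** RQ + RP ** MYQ + MR ** MY ** RS + RR ** MYS + RG)"
proof -
  let ?E = "P ** Y ** (Q - Q') + (P - P') ** (Y ** Q') + R ** Y ** (S - S') + (R - R') ** (Y ** S')
    + - (G - G')"
  have "G = P' ** Y ** Q' + (P ** Y ** (Q - Q') + (P - P') ** (Y ** Q'))
      + (R' ** Y ** S' + (R ** Y ** (S - S') + (R - R') ** (Y ** S')))"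
    using eq product_midpoint_split[of P Y Q P' Q'] product_midpoint_split[of R Y S R' S'] by simp
  then have "P' ** Y ** Q' + R' ** Y ** S' - G' = - ?E"
    by (simp add: algebra_simps)
  moreover have "majorized ?E (MP ** MY ** RQ + RP ** MYQ + MR ** MY ** RS + RR ** MYS + RG)"
    by (intro majorized_add majorized_mult P Q R S Y) (simp only: majorized_minus G)
  ultimately show ?thesis
    by (simp only: majorized_minus)
qed

lemma Diag_mult_Diag_entry:
  fixes Y :: "'a :: semiring_1 ^'n^'m"
  shows "(Diag a ** Y ** Diag b) $ i $ j = a $ i * Y $ i $ j * b $ j"
proof -
  have "(Diag a ** Y) $ i $ j = a $ i * Y $ i $ j"
    by (simp add: matrix_matrix_mult_def Diag_def if_distrib[where f = "\<lambda>x. x * _"] cong: if_cong)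
  moreover have "(M ** Diag b) $ i $ j = M $ i $ j * b $ j" for M :: "'a ^'n^'m"
    by (simp add: matrix_matrix_mult_def Diag_def if_distrib[where f = "\<lambda>x. _ * x"] cong: if_cong)
  ultimately show ?thesis
    by simp
qed

section \<open>Preconditioning and the iteration\<close>

lemma matrix_inv_right:
  assumes "invertible U"
  shows "U ** matrix_inv U = mat 1"
  using someI_ex[OF assms[unfolded invertible_def]] by (simp add: matrix_inv_def)

lemma matrix_inv_cancel:
  fixes U :: "'a :: field ^'m^'m"
  assumes "invertible U"
  shows "M ** U ** (matrix_inv U ** N) = M ** N"
proof -
  have "M ** U ** (matrix_inv U ** N) = M ** (U ** matrix_inv U) ** N"
    by (simp add: matrix_mul_assoc)
  then show ?thesis
    using assms by (simp add: matrix_inv_right)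
qed

lemma preconditioned_product:
  fixes U :: "'a :: field ^'m^'m" and V :: "'a ^'n^'n"
  assumes "invertible U" "invertible V"
  shows "matrix_inv U ** A ** U ** (matrix_inv U ** X ** V) ** (matrix_inv V ** B ** V)
    = matrix_inv U ** (A ** X ** B) ** V"
proof -
  have "matrix_inv U ** A ** U ** (matrix_inv U ** X ** V) = matrix_inv U ** A ** X ** V"
    using matrix_inv_cancel[OF assms(1), of "matrix_inv U ** A" "X ** V"]
    by (simp add: matrix_mul_assoc)
  then show ?thesis
    using matrix_inv_cancel[OF assms(2), of "matrix_inv U ** A ** X" "B ** V"]
    by (simp add: matrix_mul_assoc)
qed

theorem theorem2p6:
  fixes \<A> \<C> \<A>\<^sub>p \<C>\<^sub>p :: "'k :: {real_normed_field, euclidean_space} set ^'m^'m"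
    and \<B> \<D> \<B>\<^sub>p \<D>\<^sub>p :: "'k set ^'n^'n"
    and \<F> \<F>\<^sub>p \<Y>\<^sub>0 \<Z> :: "'k set ^'n^'m"
    and U DA DC :: "'k ^'m^'m" and V DB DD :: "'k ^'n^'n"
    and a c :: "'k ^'m" and b d :: "'k ^'n"
    and \<Y> YB YD :: "nat \<Rightarrow> 'k set ^'n^'m"
    and T :: "nat \<Rightarrow> real ^'n^'m"
    and N :: nat
  assumes arith: "interval_arithmetic iadd isub imul idiv"
    and data: "interval_matrix \<A>" "interval_matrix \<B>" "interval_matrix \<C>" "interval_matrix \<D>"
      "interval_matrix \<F>"
    and inv: "invertible U" "invertible V"
    and diag: "diagonal_matrix DA" "diagonal_matrix DB" "diagonal_matrix DC" "diagonal_matrix DD"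
    and decomp: "map_matrix imid \<A> = U ** DA ** matrix_inv U"
      "map_matrix imid \<C> = U ** DC ** matrix_inv U"
      "map_matrix imid \<B> = V ** DB ** matrix_inv V"
      "map_matrix imid \<D> = V ** DD ** matrix_inv V"
    and precond:
      "imatrix_prod3 iadd imul (point_matrix (matrix_inv U)) \<A> (point_matrix U) \<A>\<^sub>p"
      "imatrix_prod3 iadd imul (point_matrix (matrix_inv V)) \<B> (point_matrix V) \<B>\<^sub>p"
      "imatrix_prod3 iadd imul (point_matrix (matrix_inv U)) \<C> (point_matrix U) \<C>\<^sub>p"
      "imatrix_prod3 iadd imul (point_matrix (matrix_inv V)) \<D> (point_matrix V) \<D>\<^sub>p"
      "imatrix_prod3 iadd imul (point_matrix (matrix_inv U)) \<F> (point_matrix V) \<F>\<^sub>p"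
    and mid: "map_matrix imid \<A>\<^sub>p = Diag a" "map_matrix imid \<B>\<^sub>p = Diag b"
      "map_matrix imid \<C>\<^sub>p = Diag c" "map_matrix imid \<D>\<^sub>p = Diag d"
    and nonzero: "\<And>i j. a $ i * b $ j + c $ i * d $ j \<noteq> 0"
    and init: "interval_matrix \<Y>\<^sub>0"
      "united_solution_set \<A>\<^sub>p \<B>\<^sub>p \<C>\<^sub>p \<D>\<^sub>p \<F>\<^sub>p \<subseteq> imembers \<Y>\<^sub>0"
    and start: "\<Y> 0 = \<Y>\<^sub>0"
    and products: "\<And>k. k < N \<Longrightarrow>
        imatrix_prod iadd imul (\<Y> k) (point_matrix (map_matrix imid \<B>\<^sub>p)) (YB k)"
      "\<And>k. k < N \<Longrightarrow>
        imatrix_prod iadd imul (\<Y> k) (point_matrix (map_matrix imid \<D>\<^sub>p)) (YD k)"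
    and T: "\<And>k. k < N \<Longrightarrow> T k =
        map_matrix mag \<A>\<^sub>p ** map_matrix mag (\<Y> k) ** map_matrix irad \<B>\<^sub>p
        + map_matrix irad \<A>\<^sub>p ** map_matrix mag (YB k)
        + map_matrix mag \<C>\<^sub>p ** map_matrix mag (\<Y> k) ** map_matrix irad \<D>\<^sub>p
        + map_matrix irad \<C>\<^sub>p ** map_matrix mag (YD k)
        + map_matrix irad \<F>\<^sub>p"
    and step: "\<And>k i j. k < N \<Longrightarrow>
        \<exists>J \<in> pm_intervals (imid (\<F>\<^sub>p $ i $ j)) (T k $ i $ j).
          interval_inter (idiv J {a $ i * b $ j + c $ i * d $ j}) (\<Y> k $ i $ j)
            (\<Y> (Suc k) $ i $ j)"
    and result: "\<Z> = \<Y> N"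
  shows "united_solution_set \<A> \<B> \<C> \<D> \<F> \<subseteq> (\<lambda>Y. U ** Y ** matrix_inv V) ` imembers \<Z>"
proof
  fix X
  assume "X \<in> united_solution_set \<A> \<B> \<C> \<D> \<F>"
  then obtain A B C D F where mem: "A \<in> imembers \<A>" "B \<in> imembers \<B>" "C \<in> imembers \<C>"
      "D \<in> imembers \<D>" "F \<in> imembers \<F>" and eq: "A ** X ** B + C ** X ** D = F"
    by (auto simp: united_solution_set_def)
  define Y where "Y = matrix_inv U ** X ** V"
  define P where "P = matrix_inv U ** A ** U"
  define Q where "Q = matrix_inv V ** B ** V"
  define R where "R = matrix_inv U ** C ** U"
  define S where "S = matrix_inv V ** D ** V"
  define G where "G = matrix_inv U ** F ** V"
  note enclose = imatrix_prod3_encloses[OF arith _ point_matrix_interval _ _ point_matrix_interval]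
  have P: "interval_matrix \<A>\<^sub>p" "P \<in> imembers \<A>\<^sub>p"
    unfolding P_def by (rule enclose[OF precond(1) data(1) mem(1)])+
  have Q: "interval_matrix \<B>\<^sub>p" "Q \<in> imembers \<B>\<^sub>p"
    unfolding Q_def by (rule enclose[OF precond(2) data(2) mem(2)])+
  have R: "interval_matrix \<C>\<^sub>p" "R \<in> imembers \<C>\<^sub>p"
    unfolding R_def by (rule enclose[OF precond(3) data(3) mem(3)])+
  have S: "interval_matrix \<D>\<^sub>p" "S \<in> imembers \<D>\<^sub>p"
    unfolding S_def by (rule enclose[OF precond(4) data(4) mem(4)])+
  have G: "interval_matrix \<F>\<^sub>p" "G \<in> imembers \<F>\<^sub>p"
    unfolding G_def by (rule enclose[OF precond(5) data(5) mem(5)])+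
  have eqp: "P ** Y ** Q + R ** Y ** S = G"
    unfolding P_def Q_def R_def S_def G_def Y_def preconditioned_product[OF inv] eq[symmetric]
    by (simp add: matrix_add_ldistrib matrix_add_rdistrib)
  then have "Y \<in> united_solution_set \<A>\<^sub>p \<B>\<^sub>p \<C>\<^sub>p \<D>\<^sub>p \<F>\<^sub>p"
    unfolding united_solution_set_def mem_Collect_eq using P(2) Q(2) R(2) S(2) G(2) by blast
  then have Y0: "Y \<in> imembers \<Y>\<^sub>0"
    using init(2) by blast
  \<comment> \<open>Being an interval matrix is part of the invariant: without it the magnitudes in \<open>T\<close> need not
    bound anything.\<close>
  have "k \<le> N \<Longrightarrow> interval_matrix (\<Y> k) \<and> Y \<in> imembers (\<Y> k)" for k
  proof (induction k)
    case 0
    then show ?case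
      using start init(1) Y0 by simp
  next
    case (Suc k)
    then have k: "k < N" and Yk: "interval_matrix (\<Y> k)" "Y \<in> imembers (\<Y> k)"
      by auto
    note YB = imatrix_prod_encloses[OF arith products(1)[OF k] Yk point_matrix_interval]
    note YD = imatrix_prod_encloses[OF arith products(2)[OF k] Yk point_matrix_interval]
    have res: "majorized (map_matrix imid \<A>\<^sub>p ** Y ** map_matrix imid \<B>\<^sub>p
        + map_matrix imid \<C>\<^sub>p ** Y ** map_matrix imid \<D>\<^sub>p - map_matrix imid \<F>\<^sub>p) (T k)"
      unfolding T[OF k]
      by (intro midpoint_residual_bound[OF eqp] majorized_mag majorized_irad P Q R S G Yk YB YD)
    have "\<Y> (Suc k) $ i $ j \<in> intervals \<and> Y $ i $ j \<in> \<Y> (Suc k) $ i $ j" for i j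
    proof -
      let ?g = "a $ i * b $ j + c $ i * d $ j"
      obtain J where J: "J \<in> pm_intervals (imid (\<F>\<^sub>p $ i $ j)) (T k $ i $ j)"
        and inter: "interval_inter (idiv J {?g}) (\<Y> k $ i $ j) (\<Y> (Suc k) $ i $ j)"
        using step[OF k] by blast
      have "(map_matrix imid \<A>\<^sub>p ** Y ** map_matrix imid \<B>\<^sub>p
          + map_matrix imid \<C>\<^sub>p ** Y ** map_matrix imid \<D>\<^sub>p - map_matrix imid \<F>\<^sub>p) $ i $ j
          = ?g * Y $ i $ j - imid (\<F>\<^sub>p $ i $ j)"
        unfolding mid by (simp add: Diag_mult_Diag_entry algebra_simps)
      then have "norm (?g * Y $ i $ j - imid (\<F>\<^sub>p $ i $ j)) \<le> T k $ i $ j"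
        using res unfolding majorized_def by metis
      note gY = pm_intervals_contains_ball[OF this J]
      have "?g * Y $ i $ j / ?g \<in> idiv J {?g}"
        by (rule interval_arithmeticD(5)[OF arith gY(1) singleton_in_intervals])
          (use gY(2) nonzero[of i j] in auto)
      then have "Y $ i $ j \<in> idiv J {?g}"
        using nonzero[of i j] by simp
      then show ?thesis
        using interval_inter_encloses[OF inter] Yk(2) by (auto simp: imembers_def)
    qed
    then show ?case
      by (simp add: interval_matrix_def imembers_def)
  qed
  then have "Y \<in> imembers \<Z>"
    using result by simp
  moreover have "X = U ** Y ** matrix_inv V"
    using inv by (simp add: Y_def matrix_mul_assoc matrix_inv_right)
      (simp add: matrix_mul_assoc[symmetric] matrix_inv_right)
  ultimately show "X \<in> (\<lambda>Y. U ** Y ** matrix_inv V) ` imembers \<Z>"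
    by blast
qed

end
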